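(* Let $d,k,t$ be positive integers with $d\ge2$. The dimension of the algebra $\mathrm{End}_{S_d\wr S_k}\big(\mathbb{C}^{([d]\times[k])^t}\big)$ of $S_d\wr S_k$-equivariant linear endomorphisms of $\mathbb{C}^{([d]\times[k])^t}$ equals the number of pairs $(P,\{Q_1,\dots,Q_r\})$ where $P=\{P_1,\dots,P_r\}$ is a set partition of $[2t]$ into at most $k$ parts ($r=|P|$) and each $Q_i$ is a set partition of $P_i$ into at most $d$ parts. When $d,k\ge 2t$, this number is independent of $d$ and $k$: it equals the number of pairs $(P,P')$ of set partitions of $[2t]$ such that $P'$ is a refinement of $P$.
   Context: $[n]=\{1,\dots,n\}$. The wreath product $S_d\wr S_k$ consists of elements $(\bm\alpha,\beta)$ with $\bm\alpha=(\alpha_1,\dots,\alpha_k)\in S_d^k$ and $\beta\in S_k$, with product $(\bm\alpha,\beta)(\bm\eta,\zeta)=((\alpha_i\eta_{\beta^{-1}(i)})_{i\in[k]},\beta\zeta)$. It acts on $[d]\times[k]$ by $(\bm\alpha,\beta)\cdot(i,j)=(\alpha_{\beta(j)}(i),\beta(j))$, diagonally on $([d]\times[k])^t$, and by the corresponding permutation matrices on $\mathbb{C}^{([d]\times[k])^t}$. *)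

theory Defs
  imports
    "HOL-Analysis.Analysis"
    "HOL-Algebra.Group_Action"
    "HOL-Library.Function_Algebras"
    "HOL-Library.Disjoint_Sets"
begin

text \<open>The index sets \<open>[d]\<close>, \<open>[k]\<close> and \<open>[t]\<close> (tuple positions) are rendered by finite types
  \<open>'d\<close>, \<open>'k\<close>, \<open>'t\<close> with \<open>d = CARD('d)\<close>, \<open>k = CARD('k)\<close>, \<open>t = CARD('t)\<close>; all three are
  positive because types are nonempty.\<close>

definition wreath :: "(('k \<Rightarrow> 'd \<Rightarrow> 'd) \<times> ('k \<Rightarrow> 'k)) monoid" where
  "wreath = \<lparr>carrier = {(\<alpha>, \<beta>). (\<forall>i. bij (\<alpha> i)) \<and> bij \<beta>},
     monoid.mult = (\<lambda>(\<alpha>, \<beta>) (\<eta>, \<zeta>). (\<lambda>i. \<alpha> i \<circ> \<eta> (inv_into UNIV \<beta> i), \<beta> \<circ> \<zeta>)),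
     one = (\<lambda>i. id, id)\<rparr>"

fun wr_act :: "('k \<Rightarrow> 'd \<Rightarrow> 'd) \<times> ('k \<Rightarrow> 'k) \<Rightarrow> 'd \<times> 'k \<Rightarrow> 'd \<times> 'k" where
  "wr_act (\<alpha>, \<beta>) (i, j) = (\<alpha> (\<beta> j) i, \<beta> j)"

definition wr_diag :: "('k \<Rightarrow> 'd \<Rightarrow> 'd) \<times> ('k \<Rightarrow> 'k) \<Rightarrow> ('d \<times> 'k)^'t \<Rightarrow> ('d \<times> 'k)^'t" where
  "wr_diag g x = (\<chi> l. wr_act g (x $ l))"

definition wr_perm_mat ::
    "('k::finite \<Rightarrow> 'd::finite \<Rightarrow> 'd) \<times> ('k \<Rightarrow> 'k) \<Rightarrow>
     complex ^ (('d \<times> 'k)^'t::finite) ^ (('d \<times> 'k)^'t)" where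
  "wr_perm_mat g = (\<chi> x y. if x = wr_diag g y then 1 else 0)"

definition wr_End ::
    "(complex ^ (('d::finite \<times> 'k::finite)^'t::finite) \<Rightarrow> complex ^ (('d \<times> 'k)^'t)) set" where
  "wr_End = {F. Vector_Spaces.linear (*s) (*s) F \<and>
     (\<forall>g\<in>carrier wreath. \<forall>v. F (wr_perm_mat g *v v) = wr_perm_mat g *v F v)}"

text \<open>Maps into \<open>\<complex>\<^sup>X\<close> form a complex vector space under the pointwise operations; addition is
  the one on functions from \<open>Function_Algebras\<close>.\<close>

definition fun_scale :: "complex \<Rightarrow> ('a \<Rightarrow> complex ^ 'n) \<Rightarrow> 'a \<Rightarrow> complex ^ 'n" where
  "fun_scale c F = (\<lambda>v. c *s F v)"

text \<open>The second component encodes \<open>{Q\<^sub>1, \<dots>, Q\<^sub>r}\<close>, a set of set partitions.\<close>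

definition nested_partitions :: "nat \<Rightarrow> nat \<Rightarrow> nat \<Rightarrow> (nat set set \<times> nat set set set) set" where
  "nested_partitions d k n =
     {(P, \<Q>). partition_on {1..n} P \<and> card P \<le> k \<and>
        (\<exists>Q. (\<forall>p\<in>P. partition_on p (Q p) \<and> card (Q p) \<le> d) \<and> \<Q> = Q ` P)}"

lemma group_wreath: "group (wreath :: (('k \<Rightarrow> 'd \<Rightarrow> 'd) \<times> ('k \<Rightarrow> 'k)) monoid)"
proof (rule groupI, goal_cases)
  case (1 x y)
  then show ?case by (auto simp: wreath_def bij_comp)
next
  case 2
  show ?case by (simp add: wreath_def)
next
  case (3 x y z)
  then show ?case
    by (auto simp: wreath_def fun_eq_iff o_inv_distrib)
next
  case (4 x)
  then show ?case by (auto simp: wreath_def inv_id)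
next
  case (5 x)
  obtain \<alpha> \<beta> where x: "x = (\<alpha>, \<beta>)" by (cases x)
  from 5 have b: "bij \<beta>" "\<And>i. bij (\<alpha> i)" by (auto simp: wreath_def x)
  have "(\<lambda>i. inv_into UNIV (\<alpha> (\<beta> i)), inv_into UNIV \<beta>) \<in> carrier wreath"
    using b by (simp add: wreath_def bij_imp_bij_inv)
  moreover have "(\<lambda>i. inv_into UNIV (\<alpha> (\<beta> i)), inv_into UNIV \<beta>) \<otimes>\<^bsub>wreath\<^esub> x = \<one>\<^bsub>wreath\<^esub>"
    using b by (auto simp: wreath_def x fun_eq_iff inv_inv_eq bij_is_inj)
  ultimately show ?case by blast
qed

lemma wr_act_mult:
  assumes "g \<in> carrier wreath"
  shows "wr_act (g \<otimes>\<^bsub>wreath\<^esub> h) x = wr_act g (wr_act h x)"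
  using assms by (cases g; cases h; cases x) (auto simp: wreath_def bij_is_inj)

lemma wr_act_one: "wr_act \<one>\<^bsub>wreath\<^esub> x = x"
  by (cases x) (auto simp: wreath_def)

lemma vector_space_fun_scale: "vector_space (fun_scale :: _ \<Rightarrow> ('a \<Rightarrow> complex ^ 'n) \<Rightarrow> _)"
  by unfold_locales
    (auto simp: fun_scale_def fun_eq_iff vec_eq_iff algebra_simps)

lemma subspace_wr_End: "module.subspace fun_scale wr_End"
proof -
  interpret f: vector_space "fun_scale :: _ \<Rightarrow>
    (complex ^ (('d::finite \<times> 'k::finite)^'t::finite) \<Rightarrow> complex ^ (('d \<times> 'k)^'t)) \<Rightarrow> _"
    by (rule vector_space_fun_scale)
  show "f.subspace wr_End"
    unfolding f.subspace_def
  proof (intro conjI ballI allI, goal_cases)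
    case 1
    show ?case
      by (auto simp: wr_End_def zero_fun_def vec.linear_zero)
  next
    case (2 F G)
    then show ?case
      by (auto simp: wr_End_def plus_fun_def vec.linear_compose_add matrix_vector_right_distrib)
  next
    case (3 c F)
    then show ?case
      by (auto simp: wr_End_def fun_scale_def vec.linear_compose_scale_right vec.scale)
  qed
qed

end

theory Submission
  imports Defs
begin

text \<open>
  An endomorphism of \<open>\<complex>\<^sup>X\<close>, where \<open>X = ([d] \<times> [k])\<^sup>t\<close>, commutes with the permutation matrices of a
  group acting on \<open>X\<close> exactly when its matrix is constant on the orbits of that group on \<open>X \<times> X\<close>
  (\<open>wr_End_iff\<close>). The indicator matrices of the orbits are then a basis, so the dimension is
  the number of orbits, and it can be counted as the range of any complete invariant of the orbits
  (\<open>dim_wr_End_eq_card_orbits\<close>).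

  Concatenation identifies a pair in \<open>X \<times> X\<close> with a word \<open>w\<close> of length \<open>2t\<close> in the letters
  \<open>[d] \<times> [k]\<close>, on which the wreath product acts letterwise. Permutations of \<open>[k]\<close> can rename the
  second coordinates at will, so of these only the partition \<open>P\<close> of the positions by equality of the
  second coordinate survives; inside one block of \<open>P\<close> the second coordinate is constant, so a
  permutation of \<open>[d]\<close> that may be chosen separately for each block acts on the first coordinates,
  and of these only their equality pattern within the block survives. This nested partition is a
  complete invariant (\<open>nested_kernel_wr_act\<close>, \<open>nested_kernel_eqD\<close>), and it takes as values all
  nested partitions with at most \<open>k\<close> outer blocks and at most \<open>d\<close> inner blocks in each of them
  (\<open>range_nested_kernel\<close>).

  If \<open>d, k \<ge> 2t\<close>, the bounds on the numbers of blocks hold automatically, and a nested partition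
  is a partition together with a refinement of it: the union of all the inner partitions
  (\<open>card_nested_partitions_stable\<close>).
\<close>

section \<open>Kernel partitions\<close>

definition kernel_partition :: "'a set \<Rightarrow> ('a \<Rightarrow> 'b) \<Rightarrow> 'a set set" where
  "kernel_partition A f = (\<lambda>a. {b \<in> A. f b = f a}) ` A"

lemma partition_on_kernel_partition: "partition_on A (kernel_partition A f)"
  by (rule partition_onI) (auto simp: kernel_partition_def disjnt_iff)

text \<open>The blocks are fibres, so there are no more of them than values.\<close>

lemma card_kernel_partition_le: "card (kernel_partition A (f :: 'a \<Rightarrow> 'b::finite)) \<le> CARD('b)"
proof -
  have "kernel_partition A f = (\<lambda>c. {b \<in> A. f b = c}) ` f ` A"
    by (auto simp: kernel_partition_def)
  then have "card (kernel_partition A f) \<le> card (f ` A)"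
    by (simp add: card_image_le)
  also have "\<dots> \<le> CARD('b)"
    by (rule card_mono) auto
  finally show ?thesis .
qed

lemma kernel_partition_eq_iff:
  "kernel_partition A f = kernel_partition A g \<longleftrightarrow> (\<forall>a\<in>A. \<forall>b\<in>A. f a = f b \<longleftrightarrow> g a = g b)"
proof
  have *: "h' a = h' b" if "kernel_partition A h = kernel_partition A h'" "a \<in> A" "b \<in> A" "h a = h b"
    for a b and h :: "'a \<Rightarrow> 'x" and h' :: "'a \<Rightarrow> 'y"
  proof -
    have "{c \<in> A. h c = h a} \<in> kernel_partition A h'"
      using that(1,2) by (auto simp flip: that(1) simp: kernel_partition_def)
    then obtain e where "{c \<in> A. h c = h a} = {c \<in> A. h' c = h' e}"
      by (auto simp: kernel_partition_def)
    with that(2-4) have "h' a = h' e" "h' b = h' e"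
      by (auto simp: set_eq_iff)
    then show ?thesis by simp
  qed
  assume "kernel_partition A f = kernel_partition A g"
  then show "\<forall>a\<in>A. \<forall>b\<in>A. f a = f b \<longleftrightarrow> g a = g b"
    using *[of f g] *[of g f] by metis
next
  assume *: "\<forall>a\<in>A. \<forall>b\<in>A. f a = f b \<longleftrightarrow> g a = g b"
  show "kernel_partition A f = kernel_partition A g"
    unfolding kernel_partition_def by (rule image_cong) (use * in auto)
qed

lemma kernel_partition_cong:
  "(\<And>a. a \<in> A \<Longrightarrow> f a = g a) \<Longrightarrow> kernel_partition A f = kernel_partition A g"
  by (simp add: kernel_partition_eq_iff)

text \<open>Label the blocks of \<open>P\<close> injectively by values, and map each point to the label of its block.\<close>

lemma ex_kernel_partition:
  assumes P: "partition_on A P" "finite P" "card P \<le> CARD('c::finite)"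
  shows "\<exists>f :: 'a \<Rightarrow> 'c. kernel_partition A f = P"
proof -
  obtain h :: "'a set \<Rightarrow> 'c" where h: "inj_on h P"
    using card_le_inj[of P "UNIV :: 'c set"] P by auto
  have "\<forall>a\<in>A. \<exists>p\<in>P. a \<in> p"
    using partition_onD1[OF P(1)] by auto
  then obtain part where part: "\<And>a. a \<in> A \<Longrightarrow> part a \<in> P" "\<And>a. a \<in> A \<Longrightarrow> a \<in> part a"
    by metis
  have uniq: "part a = p" if "a \<in> p" "p \<in> P" for a p
  proof -
    have "a \<in> A" using that partition_onD1[OF P(1)] by auto
    then show ?thesis
      using disjointD[OF partition_onD2[OF P(1)], of "part a" p] part[of a] that by auto
  qed
  have block: "{b \<in> A. h (part b) = h (part a)} = part a" if a: "a \<in> A" for a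
  proof (intro equalityI subsetI)
    fix b assume "b \<in> {b \<in> A. h (part b) = h (part a)}"
    then show "b \<in> part a"
      using inj_onD[OF h, of "part b" "part a"] part[of b] part(1)[OF a] by auto
  next
    fix b assume "b \<in> part a"
    then show "b \<in> {b \<in> A. h (part b) = h (part a)}"
      using uniq[of b "part a"] part(1)[OF a] partition_onD1[OF P(1)] by auto
  qed
  have "kernel_partition A (\<lambda>a. h (part a)) = part ` A"
    unfolding kernel_partition_def using block by (rule image_cong[OF refl])
  also have "\<dots> = P"
  proof
    show "part ` A \<subseteq> P" using part by auto
    show "P \<subseteq> part ` A"
    proof
      fix p assume p: "p \<in> P"
      then obtain a where "a \<in> p" using partition_onD3[OF P(1)] by (metis ex_in_conv)
      then show "p \<in> part ` A" using uniq[of a p] p partition_onD1[OF P(1)] by blast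
    qed
  qed
  finally show ?thesis by blast
qed

text \<open>Equality of kernels makes \<open>f a \<mapsto> g a\<close> a well-defined bijection from \<open>f ` A\<close> to \<open>g ` A\<close>. It extends
  to a permutation because the codomain is finite and the complements of the two images therefore have
  the same size. This supplies the components of the wreath product element in
  \<open>nested_kernel_eqD\<close>.\<close>

lemma kernel_partition_bij:
  fixes f g :: "'a \<Rightarrow> 'c::finite"
  assumes "kernel_partition A f = kernel_partition A g"
  shows "\<exists>\<pi>. bij \<pi> \<and> (\<forall>a\<in>A. g a = \<pi> (f a))"
proof -
  have iff: "f a = f b \<longleftrightarrow> g a = g b" if "a \<in> A" "b \<in> A" for a b
    using assms that by (simp add: kernel_partition_eq_iff)
  define \<sigma> where "\<sigma> = g \<circ> inv_into A f"
  have \<sigma>: "\<sigma> (f a) = g a" if "a \<in> A" for a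
    using that iff[of "inv_into A f (f a)" a]
    by (simp add: \<sigma>_def inv_into_into f_inv_into_f)
  have bij_\<sigma>: "bij_betw \<sigma> (f ` A) (g ` A)"
    unfolding bij_betw_def by (auto simp: inj_on_def \<sigma> iff image_image)
  then have "card (- f ` A) = card (- g ` A)"
    by (metis bij_betw_same_card card_Diff_subset finite Compl_eq_Diff_UNIV top_greatest)
  then obtain \<tau> where "bij_betw \<tau> (- f ` A) (- g ` A)"
    by (metis finite finite_same_card_bij)
  with bij_\<sigma> have "bij_betw (\<lambda>c. if c \<in> f ` A then \<sigma> c else \<tau> c)
      (f ` A \<union> - f ` A) (g ` A \<union> - g ` A)"
    by (rule bij_betw_disjoint_Un) auto
  then show ?thesis
    by (intro exI[of _ "\<lambda>c. if c \<in> f ` A then \<sigma> c else \<tau> c"]) (auto simp: \<sigma>)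
qed

section \<open>Orbits of words\<close>

text \<open>The second component is an unindexed set of partitions, which is the encoding of
  \<^const>\<open>nested_partitions\<close>. No information is lost: each inner partition determines the outer
  block it belongs to as its union.\<close>

definition nested_kernel :: "'a set \<Rightarrow> ('a \<Rightarrow> 'd \<times> 'k) \<Rightarrow> 'a set set \<times> 'a set set set" where
  "nested_kernel A w = (kernel_partition A (snd \<circ> w),
     (\<lambda>p. kernel_partition p (fst \<circ> w)) ` kernel_partition A (snd \<circ> w))"

text \<open>Injective maps do not change equality patterns. For the first coordinates this applies
  blockwise only: which permutation acts on them depends on the second coordinate, which is constant
  on a block.\<close>

lemma nested_kernel_wr_act:
  assumes g: "g \<in> carrier wreath"
    and w': "\<And>a. a \<in> A \<Longrightarrow> w' a = wr_act g (w a)"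
  shows "nested_kernel A w' = nested_kernel A w"
proof -
  obtain \<alpha> \<beta> where g_eq: "g = (\<alpha>, \<beta>)" by (cases g)
  have \<alpha>: "\<And>i. inj (\<alpha> i)" and \<beta>: "inj \<beta>"
    using g by (auto simp: g_eq wreath_def bij_is_inj)
  have snd_w': "snd (w' a) = \<beta> (snd (w a))" and fst_w': "fst (w' a) = \<alpha> (\<beta> (snd (w a))) (fst (w a))"
    if "a \<in> A" for a
    using w'[OF that] by (cases "w a"; simp add: g_eq)+
  have outer: "kernel_partition A (snd \<circ> w') = kernel_partition A (snd \<circ> w)"
    using \<beta> by (auto simp: kernel_partition_eq_iff snd_w' inj_eq)
  have inner: "kernel_partition p (fst \<circ> w') = kernel_partition p (fst \<circ> w)"
    if p: "p \<in> kernel_partition A (snd \<circ> w)" for p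
  proof -
    obtain c where c: "p = {b \<in> A. snd (w b) = c}"
      using p by (auto simp: kernel_partition_def)
    show ?thesis
      using \<alpha> by (auto simp: kernel_partition_eq_iff c fst_w' inj_eq)
  qed
  show ?thesis
    unfolding nested_kernel_def using outer inner by (simp cong: image_cong)
qed

text \<open>Completeness of the invariant: \<open>\<beta>\<close> comes from the outer kernels and, for each value \<open>j\<close> of the
  second coordinate, a permutation \<open>\<pi> j\<close> comes from the inner kernels on the block on which that
  value is taken.\<close>

lemma nested_kernel_eqD:
  fixes w w' :: "'a \<Rightarrow> 'd::finite \<times> 'k::finite"
  assumes "nested_kernel A w = nested_kernel A w'"
  shows "\<exists>g\<in>carrier wreath. \<forall>a\<in>A. w' a = wr_act g (w a)"
proof -
  define P where "P = kernel_partition A (snd \<circ> w)"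
  have P: "kernel_partition A (snd \<circ> w') = P"
    and img: "(\<lambda>p. kernel_partition p (fst \<circ> w)) ` P = (\<lambda>p. kernel_partition p (fst \<circ> w')) ` P"
    using assms by (auto simp: nested_kernel_def P_def)
  \<comment> \<open>The two families agree a priori only as sets; taking unions matches the indices.\<close>
  have inner: "kernel_partition p (fst \<circ> w) = kernel_partition p (fst \<circ> w')" if p: "p \<in> P" for p
  proof -
    obtain q where q: "kernel_partition p (fst \<circ> w) = kernel_partition q (fst \<circ> w')"
      using p img by blast
    then have "p = q"
      by (metis partition_onD1 partition_on_kernel_partition)
    with q show ?thesis by simp
  qed
  obtain \<beta> where \<beta>: "bij \<beta>" "\<forall>a\<in>A. snd (w' a) = \<beta> (snd (w a))"
    using kernel_partition_bij[of A "snd \<circ> w" "snd \<circ> w'"] P by (auto simp: P_def)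
  have "\<exists>\<pi>. bij \<pi> \<and> (\<forall>a\<in>A. snd (w a) = j \<longrightarrow> fst (w' a) = \<pi> (fst (w a)))" for j
  proof (cases "j \<in> snd ` w ` A")
    case True
    then have "{b \<in> A. snd (w b) = j} \<in> P"
      by (auto simp: P_def kernel_partition_def)
    from kernel_partition_bij[OF inner[OF this]] show ?thesis by auto
  next
    case False
    then show ?thesis by (intro exI[of _ id]) auto
  qed
  then obtain \<pi> where \<pi>: "\<And>j. bij (\<pi> j)"
    "\<And>a. a \<in> A \<Longrightarrow> fst (w' a) = \<pi> (snd (w a)) (fst (w a))"
    by metis
  \<comment> \<open>The action indexes the tuple \<open>\<alpha>\<close> by the new second coordinate \<open>\<beta> j\<close>, whereas \<open>\<pi>\<close> is indexed
    by the old one; hence the inverse of \<open>\<beta>\<close>.\<close>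
  have "(\<lambda>i. \<pi> (inv_into UNIV \<beta> i), \<beta>) \<in> carrier wreath"
    using \<beta> \<pi> by (simp add: wreath_def)
  moreover have "w' a = wr_act (\<lambda>i. \<pi> (inv_into UNIV \<beta> i), \<beta>) (w a)" if "a \<in> A" for a
    using that \<beta> \<pi>(2)[OF that] by (cases "w a"; cases "w' a") (auto simp: bij_is_inj)
  ultimately show ?thesis by blast
qed

lemma range_nested_kernel:
  "range (nested_kernel {1..n} :: (nat \<Rightarrow> 'd::finite \<times> 'k::finite) \<Rightarrow> _)
   = nested_partitions CARD('d) CARD('k) n"
proof
  show "range (nested_kernel {1..n} :: (nat \<Rightarrow> 'd \<times> 'k) \<Rightarrow> _)
      \<subseteq> nested_partitions CARD('d) CARD('k) n"
    unfolding nested_kernel_def nested_partitions_def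
    by (auto intro!: partition_on_kernel_partition card_kernel_partition_le
        exI[of _ "\<lambda>p. kernel_partition p (fst \<circ> w)" for w])
  show "nested_partitions CARD('d) CARD('k) n
      \<subseteq> range (nested_kernel {1..n} :: (nat \<Rightarrow> 'd \<times> 'k) \<Rightarrow> _)"
  proof
    fix x assume "x \<in> nested_partitions CARD('d) CARD('k) n"
    then obtain P Q where x: "x = (P, Q ` P)" and P: "partition_on {1..n} P" "card P \<le> CARD('k)"
      and Q: "\<And>p. p \<in> P \<Longrightarrow> partition_on p (Q p)" "\<And>p. p \<in> P \<Longrightarrow> card (Q p) \<le> CARD('d)"
      unfolding nested_partitions_def by blast
    have fin: "finite P" using P finite_elements by blast
    have finQ: "finite (Q p)" if "p \<in> P" for p
    proof (rule finite_elements[OF _ Q(1)[OF that]])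
      show "finite p"
        using that partition_onD1[OF P(1)] by (metis Union_upper finite_atLeastAtMost finite_subset)
    qed
    obtain f :: "nat \<Rightarrow> 'k" where f: "kernel_partition {1..n} f = P"
      using ex_kernel_partition[OF P(1) fin P(2)] by blast
    have "\<forall>p\<in>P. \<exists>h :: nat \<Rightarrow> 'd. kernel_partition p h = Q p"
      using ex_kernel_partition[OF Q(1) finQ Q(2)] by blast
    then obtain h :: "nat set \<Rightarrow> nat \<Rightarrow> 'd" where h: "\<And>p. p \<in> P \<Longrightarrow> kernel_partition p (h p) = Q p"
      by metis
    define w where "w a = (h {b \<in> {1..n}. f b = f a} a, f a)" for a
    have w: "kernel_partition p (fst \<circ> w) = Q p" if p: "p \<in> P" for p
    proof -
      obtain c where c: "p = {b \<in> {1..n}. f b = f c}"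
        using p unfolding f[symmetric] by (auto simp: kernel_partition_def)
      have "kernel_partition p (fst \<circ> w) = kernel_partition p (h p)"
        by (rule kernel_partition_cong) (auto simp: w_def c)
      then show ?thesis using h[OF p] by simp
    qed
    have "snd \<circ> w = f" by (auto simp: w_def)
    then have "nested_kernel {1..n} w = x"
      unfolding nested_kernel_def x by (simp only: f prod.inject) (simp add: w cong: image_cong)
    then show "x \<in> range (nested_kernel {1..n} :: (nat \<Rightarrow> 'd \<times> 'k) \<Rightarrow> _)" by blast
  qed
qed

section \<open>Equivariant endomorphisms\<close>

lemma bij_wr_diag:
  assumes "g \<in> carrier (wreath :: (('k \<Rightarrow> 'd \<Rightarrow> 'd) \<times> ('k \<Rightarrow> 'k)) monoid)"
  shows "bij (wr_diag g :: ('d \<times> 'k)^'t \<Rightarrow> _)"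
proof (rule o_bij)
  interpret W: group "wreath :: (('k \<Rightarrow> 'd \<Rightarrow> 'd) \<times> ('k \<Rightarrow> 'k)) monoid"
    by (rule group_wreath)
  let ?h = "inv\<^bsub>wreath\<^esub> g"
  show "wr_diag ?h \<circ> wr_diag g = (id :: ('d \<times> 'k)^'t \<Rightarrow> _)"
    using assms by (simp add: fun_eq_iff wr_diag_def wr_act_one vec_eq_iff flip: wr_act_mult)
  show "wr_diag g \<circ> wr_diag ?h = (id :: ('d \<times> 'k)^'t \<Rightarrow> _)"
    using assms by (simp add: fun_eq_iff wr_diag_def wr_act_one vec_eq_iff flip: wr_act_mult)
qed

lemma wr_perm_mat_mult:
  assumes "g \<in> carrier wreath"
  shows "(wr_perm_mat g *v v) $ wr_diag g x = v $ x"
proof -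
  have "(wr_perm_mat g *v v) $ wr_diag g x = (\<Sum>y\<in>UNIV. (if x = y then 1 else 0) * v $ y)"
    by (simp add: wr_perm_mat_def matrix_vector_mult_def inj_eq[OF bij_is_inj[OF bij_wr_diag[OF assms]]])
  also have "\<dots> = (\<Sum>y\<in>UNIV. if x = y then v $ y else 0)"
    by (rule sum.cong) auto
  finally have "(wr_perm_mat g *v v) $ wr_diag g x = (\<Sum>y\<in>UNIV. if x = y then v $ y else 0)" .
  then show ?thesis by simp
qed

lemma matrix_vector_mult_axis: "(M *v axis y 1) $ x = (M :: 'a::field ^ 'n::finite ^ 'm::finite) $ x $ y"
proof -
  have "M $ x $ y = matrix ((*v) M) $ x $ y" by simp
  then show ?thesis by (simp only: matrix_def vec_lambda_beta)
qed

text \<open>Evaluating \<open>F (g v) = g (F v)\<close> on basis vectors gives invariance of the matrix entries;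
  conversely, invariance allows the sum that defines the matrix-vector product to be reindexed
  along \<open>g\<close>.\<close>

lemma wr_End_iff:
  "F \<in> wr_End \<longleftrightarrow> (\<exists>M. F = (*v) M \<and>
     (\<forall>g\<in>carrier wreath. \<forall>x y. M $ wr_diag g x $ wr_diag g y = M $ x $ y))"
proof (intro iffI; (elim exE conjE)?)
  assume F: "F \<in> wr_End"
  then have FM: "F = (*v) (matrix F)"
    by (auto simp: wr_End_def fun_eq_iff matrix_works)
  have entry: "matrix F $ x $ y = F (axis y 1) $ x" for x y
    by (simp add: matrix_def)
  have "matrix F $ wr_diag g x $ wr_diag g y = matrix F $ x $ y" if g: "g \<in> carrier wreath" for g x y
  proof -
    have "wr_perm_mat g *v axis y 1 = axis (wr_diag g y) 1"
      unfolding vec_eq_iff[of "wr_perm_mat g *v axis y 1"]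
      unfolding matrix_vector_mult_axis by (simp add: wr_perm_mat_def axis_def)
    then have "matrix F $ wr_diag g x $ wr_diag g y = F (wr_perm_mat g *v axis y 1) $ wr_diag g x"
      by (simp add: entry)
    also have "\<dots> = (wr_perm_mat g *v F (axis y 1)) $ wr_diag g x"
      using F g by (simp add: wr_End_def)
    also have "\<dots> = matrix F $ x $ y"
      by (simp add: wr_perm_mat_mult[OF g] entry)
    finally show ?thesis .
  qed
  with FM show "\<exists>M. F = (*v) M \<and>
     (\<forall>g\<in>carrier wreath. \<forall>x y. M $ wr_diag g x $ wr_diag g y = M $ x $ y)" by blast
next
  fix M
  assume F: "F = (*v) M"
    and M: "\<forall>g\<in>carrier wreath. \<forall>x y. M $ wr_diag g x $ wr_diag g y = M $ x $ y"
  have "M *v (wr_perm_mat g *v v) = wr_perm_mat g *v (M *v v)" if g: "g \<in> carrier wreath" for g v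
  proof -
    note bij = bij_wr_diag[OF g]
    have "(M *v (wr_perm_mat g *v v)) $ wr_diag g x = (wr_perm_mat g *v (M *v v)) $ wr_diag g x" for x
    proof -
      have "(M *v (wr_perm_mat g *v v)) $ wr_diag g x
          = (\<Sum>y\<in>UNIV. M $ wr_diag g x $ y * (wr_perm_mat g *v v) $ y)"
        by (simp add: matrix_vector_mult_def)
      also have "\<dots> = (\<Sum>z\<in>UNIV. M $ wr_diag g x $ wr_diag g z * (wr_perm_mat g *v v) $ wr_diag g z)"
        by (rule sum.reindex_bij_betw[OF bij, symmetric])
      also have "\<dots> = (\<Sum>z\<in>UNIV. M $ x $ z * v $ z)"
        using M g by (simp add: wr_perm_mat_mult)
      also have "\<dots> = (wr_perm_mat g *v (M *v v)) $ wr_diag g x"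
        by (simp add: wr_perm_mat_mult[OF g]) (simp add: matrix_vector_mult_def)
      finally show ?thesis .
    qed
    then show ?thesis
      unfolding vec_eq_iff using bij_is_surj[OF bij] by (metis surjD)
  qed
  then show "F \<in> wr_End" by (simp add: wr_End_def F)
qed

text \<open>The hypothesis says that \<open>T\<close> is a complete invariant of the diagonal orbits on pairs. The
  indicator matrices of the level sets of \<open>T\<close> form the basis; since the level sets partition the
  matrix positions, the coefficients of a linear combination can be read off from its entries.\<close>

lemma dim_wr_End_eq_card_orbits:
  fixes T :: "('d::finite \<times> 'k::finite)^'t::finite \<Rightarrow> ('d \<times> 'k)^'t \<Rightarrow> 'c"
  assumes T: "\<And>x y x' y'. T x y = T x' y' \<longleftrightarrow>
    (\<exists>g\<in>carrier wreath. x' = wr_diag g x \<and> y' = wr_diag g y)"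
  shows "vector_space.dim fun_scale
      (wr_End :: (complex ^ (('d \<times> 'k)^'t) \<Rightarrow> complex ^ (('d \<times> 'k)^'t)) set)
    = card (range (case_prod T))"
proof -
  interpret f: vector_space "fun_scale :: _ \<Rightarrow>
    (complex ^ (('d \<times> 'k)^'t) \<Rightarrow> complex ^ (('d \<times> 'k)^'t)) \<Rightarrow> _"
    by (rule vector_space_fun_scale)
  define C where "C = range (case_prod T)"
  define E :: "'c \<Rightarrow> complex ^ (('d \<times> 'k)^'t) \<Rightarrow> complex ^ (('d \<times> 'k)^'t)"
    where "E c = (*v) (\<chi> x y. if T x y = c then 1 else 0)" for c
  have fin: "finite C" by (simp add: C_def)
  have T_inC: "T x y \<in> C" for x y by (auto simp: C_def)
  have E_axis: "E c (axis y 1) $ x = (if T x y = c then 1 else 0)" for c x y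
    by (simp add: E_def matrix_vector_mult_axis)
  have comb_axis: "(\<Sum>c\<in>C. fun_scale (a c) (E c)) (axis y 1) $ x = a (T x y)" for a x y
  proof -
    have "(\<Sum>c\<in>C. fun_scale (a c) (E c)) (axis y 1) $ x = (\<Sum>c\<in>C. a c * E c (axis y 1) $ x)"
      using fin by (induction C rule: finite_induct) (auto simp: fun_scale_def)
    also have "\<dots> = a (T x y)"
      using fin T_inC by (simp add: E_axis if_distrib cong: if_cong)
    finally show ?thesis .
  qed
  have inj: "inj_on E C"
  proof (rule inj_onI)
    fix c c' assume "c \<in> C" "c' \<in> C" "E c = E c'"
    then obtain x y where "T x y = c" by (auto simp: C_def)
    then show "c = c'"
      using E_axis[of c y x] E_axis[of c' y x] \<open>E c = E c'\<close> by (auto split: if_splits)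
  qed
  have sub: "E ` C \<subseteq> wr_End"
  proof
    fix F assume "F \<in> E ` C"
    then obtain c where F: "F = E c" by blast
    have "T (wr_diag g x) (wr_diag g y) = T x y" if "g \<in> carrier wreath" for g x y
      using T[of x y "wr_diag g x" "wr_diag g y"] that by auto
    then show "F \<in> wr_End"
      unfolding wr_End_iff F E_def by (intro exI conjI) (rule refl, simp)
  qed
  have span: "wr_End \<subseteq> f.span (E ` C)"
  proof
    fix F :: "complex ^ (('d \<times> 'k)^'t) \<Rightarrow> complex ^ (('d \<times> 'k)^'t)"
    assume "F \<in> wr_End"
    then obtain M where F: "F = (*v) M"
      and M: "\<forall>g\<in>carrier wreath. \<forall>x y. M $ wr_diag g x $ wr_diag g y = M $ x $ y"
      unfolding wr_End_iff by blast
    have const: "M $ x $ y = M $ x' $ y'" if "T x y = T x' y'" for x y x' y'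
      using that M unfolding T by metis
    define a where "a c = (let (x, y) = SOME z. case_prod T z = c in M $ x $ y)" for c
    have a: "a (T x y) = M $ x $ y" for x y
    proof -
      have "case_prod T (SOME z. case_prod T z = T x y) = T x y"
        by (rule someI[of _ "(x, y)"]) simp
      then show ?thesis
        unfolding a_def Let_def by (auto split: prod.splits intro: const)
    qed
    let ?G = "\<Sum>c\<in>C. fun_scale (a c) (E c)"
    have "?G \<in> wr_End"
      using sub by (auto intro!: f.subspace_sum[OF subspace_wr_End] f.subspace_scale[OF subspace_wr_End])
    then obtain N where N: "?G = (*v) N" unfolding wr_End_iff by blast
    have entries: "N $ x $ y = M $ x $ y" for x y
      using comb_axis[of a y x] unfolding N a
      by (simp add: matrix_vector_mult_axis)
    have "N = M" using entries by (simp add: vec_eq_iff)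
    then have "F = ?G" unfolding N F by simp
    then show "F \<in> f.span (E ` C)"
      by (auto intro!: f.span_sum f.span_scale intro: f.span_base)
  qed
  have indep: "f.independent (E ` C)"
  proof (rule f.independent_if_scalars_zero)
    show "finite (E ` C)" using fin by simp
    fix b F assume z: "(\<Sum>G\<in>E ` C. fun_scale (b G) G) = 0" and "F \<in> E ` C"
    then obtain x y where F: "F = E (T x y)" by (auto simp: C_def)
    have "(\<Sum>c\<in>C. fun_scale (b (E c)) (E c)) = 0"
      using z by (simp add: sum.reindex[OF inj])
    then show "b F = 0"
      using comb_axis[of "\<lambda>c. b (E c)" y x] by (simp add: F)
  qed
  have "card (E ` C) = card C" by (rule card_image[OF inj])
  with f.dim_unique[OF sub span indep] show ?thesis by (simp add: C_def)
qed

section \<open>Nested partitions and refinements\<close>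

lemma card_partition_le:
  assumes "finite A" "partition_on A P"
  shows "card P \<le> card A"
proof -
  obtain r where r: "\<And>p. p \<in> P \<Longrightarrow> r p \<in> p"
    using partition_onD3[OF assms(2)] by (metis ex_in_conv)
  have "inj_on r P"
    using r partition_onD2[OF assms(2)] by (auto simp: inj_on_def disjoint_def) (metis IntI emptyE)+
  moreover have "r ` P \<subseteq> A" using r partition_onD1[OF assms(2)] by auto
  ultimately show ?thesis using assms(1) card_inj_on_le by blast
qed

text \<open>The bijection is \<open>(P, \<Q>) \<mapsto> (P, \<Union>\<Q>)\<close>. The inner partition of a block \<open>p\<close> is recovered
  from the refinement as the set of those parts that lie inside \<open>p\<close>.\<close>

lemma card_nested_partitions_stable:
  assumes "n \<le> d" "n \<le> k"
  shows "card (nested_partitions d k n)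
    = card {(P, P'). partition_on {1..n} P \<and> partition_on {1..n} P' \<and> refines {1..n} P' P}"
    (is "_ = card ?R")
proof (rule bij_betw_same_card[of "\<lambda>(P, \<Q>). (P, \<Union>\<Q>)"])
  have recover: "Q p = {q \<in> \<Union>(Q ` P). q \<subseteq> p}"
    if P: "partition_on {1..n} P" and Q: "\<And>p. p \<in> P \<Longrightarrow> partition_on p (Q p)" and p: "p \<in> P" for P Q p
  proof (intro equalityI subsetI)
    fix q assume "q \<in> Q p"
    then show "q \<in> {q \<in> \<Union>(Q ` P). q \<subseteq> p}"
      using p partition_onD1[OF Q[OF p]] by auto
  next
    fix q assume "q \<in> {q \<in> \<Union>(Q ` P). q \<subseteq> p}"
    then obtain p' where p': "p' \<in> P" "q \<in> Q p'" "q \<subseteq> p" by auto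
    then have "q \<subseteq> p'" "q \<noteq> {}"
      using partition_onD1[OF Q[OF p'(1)]] partition_onD3[OF Q[OF p'(1)]] by auto
    then have "p \<inter> p' \<noteq> {}" using p' by auto
    then have "p = p'" using p p' partition_onD2[OF P] by (auto simp: disjoint_def)
    then show "q \<in> Q p" using p' by simp
  qed
  show "bij_betw (\<lambda>(P, \<Q>). (P, \<Union>\<Q>)) (nested_partitions d k n) ?R"
    unfolding bij_betw_def
  proof (intro conjI equalityI subsetI)
    show "inj_on (\<lambda>(P, \<Q>). (P, \<Union>\<Q>)) (nested_partitions d k n)"
    proof (rule inj_onI)
      fix x y
      assume "x \<in> nested_partitions d k n" "y \<in> nested_partitions d k n"
        and eq: "(case x of (P, \<Q>) \<Rightarrow> (P, \<Union>\<Q>)) = (case y of (P, \<Q>) \<Rightarrow> (P, \<Union>\<Q>))"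
      then obtain P Q Q' where x: "x = (P, Q ` P)" and y: "y = (P, Q' ` P)"
        and *: "partition_on {1..n} P" "\<And>p. p \<in> P \<Longrightarrow> partition_on p (Q p)"
          "\<And>p. p \<in> P \<Longrightarrow> partition_on p (Q' p)"
        unfolding nested_partitions_def by auto
      have "\<Union>(Q ` P) = \<Union>(Q' ` P)" using eq by (simp add: x y)
      then have "Q p = Q' p" if "p \<in> P" for p
        using recover[of P Q p] recover[of P Q' p] * that by simp
      then show "x = y" by (simp add: x y cong: image_cong)
    qed
  next
    fix z assume "z \<in> (\<lambda>(P, \<Q>). (P, \<Union>\<Q>)) ` nested_partitions d k n"
    then obtain P Q where z: "z = (P, \<Union>(Q ` P))" and P: "partition_on {1..n} P"
      and Q: "\<And>p. p \<in> P \<Longrightarrow> partition_on p (Q p)"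
      unfolding nested_partitions_def by auto
    have cover: "\<Union>(\<Union>(Q ` P)) = {1..n}"
      using partition_onD1[OF P] partition_onD1[OF Q] by blast
    have disj: "disjoint (\<Union>(Q ` P))"
    proof (rule disjoint_UN)
      show "disjoint (Q p)" if "p \<in> P" for p using partition_onD2[OF Q[OF that]] .
      show "disjoint_family_on (\<lambda>p. \<Union>(Q p)) P"
        using partition_onD1[OF Q] partition_onD2[OF P]
        by (simp add: disjoint_family_on_def disjoint_def)
    qed
    have "{} \<notin> \<Union>(Q ` P)" using partition_onD3[OF Q] by auto
    with cover disj have part: "partition_on {1..n} (\<Union>(Q ` P))" by (simp add: partition_on_def)
    moreover have "\<exists>p\<in>P. q \<subseteq> p" if "q \<in> \<Union>(Q ` P)" for q
      using that partition_onD1[OF Q] by blast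
    ultimately show "z \<in> ?R" using P by (auto simp: z refines_def)
  next
    fix z assume "z \<in> ?R"
    then obtain P P' where z: "z = (P, P')" and P: "partition_on {1..n} P"
      and ref: "refines {1..n} P' P" by blast
    define Q where "Q p = {q \<in> P'. q \<subseteq> p}" for p
    have Q: "partition_on p (Q p)" if "p \<in> P" for p
      unfolding Q_def using refines_obtains_subset[OF ref that] .
    have small: "card p \<le> n" "finite p" if "p \<in> P" for p
    proof -
      have "p \<subseteq> {1..n}" using that partition_onD1[OF P] by auto
      then show "card p \<le> n" "finite p"
        using card_mono[of "{1..n}" p] by (auto intro: finite_subset)
    qed
    have "card P \<le> k" using card_partition_le[OF _ P] assms by simp
    moreover have "card (Q p) \<le> d" if "p \<in> P" for p
      using card_partition_le[OF small(2)[OF that] Q[OF that]] small(1)[OF that] assms by simp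
    ultimately have "(P, Q ` P) \<in> nested_partitions d k n"
      unfolding nested_partitions_def using P Q by blast
    moreover have "\<Union>(Q ` P) = P'"
      using ref by (auto simp: Q_def refines_def)
    ultimately show "z \<in> (\<lambda>(P, \<Q>). (P, \<Union>\<Q>)) ` nested_partitions d k n"
      unfolding z by force
  qed
qed

section \<open>The dimension formula\<close>

theorem mainTheorem2:
  assumes "CARD('d::finite) \<ge> 2"
  shows "vector_space.dim fun_scale
           (wr_End :: (complex ^ (('d \<times> 'k::finite)^'t::finite) \<Rightarrow> complex ^ (('d \<times> 'k)^'t)) set)
         = card (nested_partitions CARD('d) CARD('k) (2 * CARD('t))) \<and>
         (CARD('d) \<ge> 2 * CARD('t) \<and> CARD('k) \<ge> 2 * CARD('t) \<longrightarrow>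
           card (nested_partitions CARD('d) CARD('k) (2 * CARD('t)))
           = card {(P, P'). partition_on {1..2 * CARD('t)} P \<and>
                            partition_on {1..2 * CARD('t)} P' \<and>
                            refines {1..2 * CARD('t)} P' P})"
proof (intro conjI impI)
  let ?A = "{1..2 * CARD('t)}"
  \<comment> \<open>A word lists the letters of the row index \<open>x\<close> and of the column index \<open>y\<close> in an arbitrary
    order \<open>e\<close>.\<close>
  have "card ?A = CARD('t + 't)" by simp
  then obtain e :: "nat \<Rightarrow> 't + 't" where e: "bij_betw e ?A UNIV"
    by (metis finite finite_atLeastAtMost finite_same_card_bij)
  define word :: "('d \<times> 'k)^'t \<Rightarrow> ('d \<times> 'k)^'t \<Rightarrow> nat \<Rightarrow> 'd \<times> 'k"
    where "word x y = case_sum (($) x) (($) y) \<circ> e" for x y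
  define T where "T x y = nested_kernel ?A (word x y)" for x y
  have all_e: "(\<forall>a\<in>?A. R (e a)) \<longleftrightarrow> (\<forall>l. R (Inl l)) \<and> (\<forall>l. R (Inr l))" for R
  proof -
    have "(\<forall>a\<in>?A. R (e a)) \<longleftrightarrow> (\<forall>s\<in>e ` ?A. R s)" by simp
    also have "\<dots> \<longleftrightarrow> (\<forall>l. R (Inl l)) \<and> (\<forall>l. R (Inr l))"
      unfolding bij_betw_imp_surj_on[OF e] by (metis UNIV_I sum.exhaust)
    finally show ?thesis .
  qed
  have act: "(\<forall>a\<in>?A. word x' y' a = wr_act g (word x y a)) \<longleftrightarrow> x' = wr_diag g x \<and> y' = wr_diag g y"
    for g x y x' y'
    using all_e[of "\<lambda>s. case_sum (($) x') (($) y') s = wr_act g (case_sum (($) x) (($) y) s)"]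
    by (simp add: word_def wr_diag_def vec_eq_iff)
  have "T x y = T x' y' \<longleftrightarrow> (\<exists>g\<in>carrier wreath. x' = wr_diag g x \<and> y' = wr_diag g y)" for x y x' y'
    unfolding T_def act[symmetric]
    using nested_kernel_eqD[of ?A "word x y" "word x' y'"]
      nested_kernel_wr_act[of _ ?A "word x' y'" "word x y"] by metis
  then have "vector_space.dim fun_scale
      (wr_End :: (complex ^ (('d \<times> 'k)^'t) \<Rightarrow> complex ^ (('d \<times> 'k)^'t)) set)
    = card (range (case_prod T))"
    by (rule dim_wr_End_eq_card_orbits)
  also have "range (case_prod T) = range (nested_kernel ?A :: (nat \<Rightarrow> 'd \<times> 'k) \<Rightarrow> _)"
  proof (intro equalityI subsetI)
    fix c assume "c \<in> range (nested_kernel ?A :: (nat \<Rightarrow> 'd \<times> 'k) \<Rightarrow> _)"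
    then obtain w :: "nat \<Rightarrow> 'd \<times> 'k" where c: "c = nested_kernel ?A w" by blast
    define x y :: "('d \<times> 'k)^'t" where "x = (\<chi> l. w (inv_into ?A e (Inl l)))"
      and "y = (\<chi> l. w (inv_into ?A e (Inr l)))"
    \<comment> \<open>The two words agree only on the positions \<open>?A\<close>; invariance under the neutral element bridges
      the difference.\<close>
    have "word x y a = wr_act \<one>\<^bsub>wreath\<^esub> (w a)" if "a \<in> ?A" for a
      using bij_betw_inv_into_left[OF e that]
      by (cases "e a") (auto simp: word_def x_def y_def wr_act_one)
    then have "T x y = c"
      unfolding T_def c
      by (rule nested_kernel_wr_act[rotated]) (simp_all add: group.is_monoid[OF group_wreath] monoid.one_closed)
    then show "c \<in> range (case_prod T)" by force
  qed (auto simp: T_def)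
  finally show "vector_space.dim fun_scale
      (wr_End :: (complex ^ (('d \<times> 'k)^'t) \<Rightarrow> complex ^ (('d \<times> 'k)^'t)) set)
    = card (nested_partitions CARD('d) CARD('k) (2 * CARD('t)))"
    unfolding range_nested_kernel .
next
  assume "CARD('d) \<ge> 2 * CARD('t) \<and> CARD('k) \<ge> 2 * CARD('t)"
  then show "card (nested_partitions CARD('d) CARD('k) (2 * CARD('t)))
    = card {(P, P'). partition_on {1..2 * CARD('t)} P \<and> partition_on {1..2 * CARD('t)} P' \<and>
                     refines {1..2 * CARD('t)} P' P}"
    using card_nested_partitions_stable by blast
qed

end
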